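(* Let $\mathbb{K}\in\{\mathbb{R},\mathbb{C}\}$, let $(w_i)_{i\in\mathbb{N}}$ be a sequence of nonnegative real numbers, let $a,A\in\mathbb{K}$ and let $\overline{x}=(x_i)_{i\in\mathbb{N}},\ \overline{y}=(y_i)_{i\in\mathbb{N}}\in\ell^2_w(\mathbb{K})$. If $$\sum_{i=0}^\infty w_i\operatorname{Re}\left[(Ay_i-x_i)\left(\overline{x_i}-\overline{a}\,\overline{y_i}\right)\right]\ge 0,$$ then $$0\le \sum_{i=0}^\infty w_i|x_i|^2\sum_{i=0}^\infty w_i|y_i|^2-\left|\sum_{i=0}^\infty w_ix_i\overline{y_i}\right|^2\le\frac14|A-a|^2\left(\sum_{i=0}^\infty w_i|y_i|^2\right)^2 .$$ The constant $\frac14$ is sharp, in the sense that there is no constant $C<\frac14$ for which the right-hand inequality, with $\frac14$ replaced by $C$, holds for all sequences $(w_i)_{i\in\mathbb{N}}$ of nonnegative real numbers, all $a,A\in\mathbb{K}$ and all $\overline{x},\overline{y}\in\ell^2_w(\mathbb{K})$ satisfying $\sum_{i=0}^\infty w_i\operatorname{Re}\left[(Ay_i-x_i)\left(\overline{x_i}-\overline{a}\,\overline{y_i}\right)\right]\ge 0$.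
   Context: $\mathbb{N}=\{0,1,2,\dots\}$ and $\ell^2_w(\mathbb{K})=\left\{\overline{x}=(x_i)_{i\in\mathbb{N}}\subset\mathbb{K} : \sum_{i=0}^\infty w_i|x_i|^2<\infty\right\}$. *)

theory Defs
  imports Complex_Main
begin

text \<open>The scalar field is a set \<open>K\<close> of complex numbers; \<open>\<real>\<close> and \<open>UNIV\<close> give the real and the
  complex case.\<close>

definition ell2w :: "(nat \<Rightarrow> real) \<Rightarrow> complex set \<Rightarrow> (nat \<Rightarrow> complex) set" where
  "ell2w w K = {x. range x \<subseteq> K \<and> summable (\<lambda>i. w i * (cmod (x i))\<^sup>2)}"

text \<open>The following two facts show that the infinite sums of mixed terms over elements of
  \<open>ell2w w K\<close> converge, so that \<open>suminf\<close> is meaningful on them.\<close>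

lemma summable_ell2w_inner:
  assumes w: "\<And>i. 0 \<le> w i" and x: "x \<in> ell2w w K" and y: "y \<in> ell2w w K"
  shows "summable (\<lambda>i. complex_of_real (w i) * x i * cnj (y i))"
proof (rule summable_comparison_test)
  show "summable (\<lambda>i. w i * (cmod (x i))\<^sup>2 + w i * (cmod (y i))\<^sup>2)"
    using x y by (auto simp: ell2w_def intro: summable_add)
  have "w i * (cmod (x i) * cmod (y i)) \<le> w i * ((cmod (x i))\<^sup>2 + (cmod (y i))\<^sup>2)" for i
  proof (rule mult_left_mono[OF _ w])
    have "2 * (cmod (x i) * cmod (y i)) \<le> (cmod (x i))\<^sup>2 + (cmod (y i))\<^sup>2"
      using sum_squares_bound[of "cmod (x i)" "cmod (y i)"] by (simp add: mult.assoc)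
    moreover have "0 \<le> cmod (x i) * cmod (y i)" by simp
    ultimately show "cmod (x i) * cmod (y i) \<le> (cmod (x i))\<^sup>2 + (cmod (y i))\<^sup>2" by linarith
  qed
  then show "\<exists>N. \<forall>n\<ge>N. norm (complex_of_real (w n) * x n * cnj (y n))
      \<le> w n * (cmod (x n))\<^sup>2 + w n * (cmod (y n))\<^sup>2"
    using w by (simp add: norm_mult distrib_left mult.assoc)
qed

lemma summable_ell2w_Re:
  assumes w: "\<And>i. 0 \<le> w i" and x: "x \<in> ell2w w K" and y: "y \<in> ell2w w K"
  shows "summable (\<lambda>i. w i * Re ((A * y i - x i) * (cnj (x i) - cnj a * cnj (y i))))"
proof -
  note s = summable_ell2w_inner[OF w]
  have "summable (\<lambda>i. A * (complex_of_real (w i) * y i * cnj (x i))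
      - A * cnj a * (complex_of_real (w i) * y i * cnj (y i))
      - complex_of_real (w i) * x i * cnj (x i)
      + cnj a * (complex_of_real (w i) * x i * cnj (y i)))"
    by (intro summable_add summable_diff summable_mult s[OF x x] s[OF x y] s[OF y x] s[OF y y])
  from summable_Re[OF this] show ?thesis
    by (rule back_subst[of summable]) (auto simp: fun_eq_iff algebra_simps)
qed

end

(* With X, Y the weighted squared norms, P the weighted inner product and m = (A + a)/2, the
   hypothesis says that the weighted squared norm Q of x - m y is at most |A - a|^2 Y / 4, and
   X Y - |P|^2 = Q Y - |P - m Y|^2.  Equality holds for y = (1, 1), x = (1, -1), A = 1, a = -1
   with unit weights. *)

theory Submission
  imports Defs
begin

text \<open>The real part is invariant under conjugation, so \<open>A * y i * cnj (x i)\<close> may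
  be traded for \<open>cnj A * x i * cnj (y i)\<close>. Both cross terms then share the single inner
  product P, with factor \<open>cnj A + cnj a\<close>, and the hypothesis of the theorem turns into
  a linear inequality between X, Y and P.\<close>

lemma suminf_ell2w_diff:
  assumes w: "\<And>i. 0 \<le> w i" and x: "x \<in> ell2w w K" and y: "y \<in> ell2w w K"
  shows "(\<Sum>i. w i * Re ((A * y i - x i) * (cnj (x i) - cnj a * cnj (y i))))
    = Re ((cnj A + cnj a) * (\<Sum>i. complex_of_real (w i) * x i * cnj (y i)))
      - Re (A * cnj a) * (\<Sum>i. w i * (cmod (y i))\<^sup>2) - (\<Sum>i. w i * (cmod (x i))\<^sup>2)"
proof -
  have "(\<lambda>i. complex_of_real (w i) * x i * cnj (y i)) sums
      (\<Sum>i. complex_of_real (w i) * x i * cnj (y i))"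
    using summable_ell2w_inner[OF w x y] by (rule summable_sums)
  then have P: "(\<lambda>i. Re ((cnj A + cnj a) * (complex_of_real (w i) * x i * cnj (y i)))) sums
      Re ((cnj A + cnj a) * (\<Sum>i. complex_of_real (w i) * x i * cnj (y i)))"
    by (intro sums_Re sums_mult)
  have X: "(\<lambda>i. w i * (cmod (x i))\<^sup>2) sums (\<Sum>i. w i * (cmod (x i))\<^sup>2)"
    using x by (auto simp: ell2w_def)
  have "(\<lambda>i. w i * (cmod (y i))\<^sup>2) sums (\<Sum>i. w i * (cmod (y i))\<^sup>2)"
    using y by (auto simp: ell2w_def)
  then have Y: "(\<lambda>i. Re (A * cnj a) * (w i * (cmod (y i))\<^sup>2)) sums
      (Re (A * cnj a) * (\<Sum>i. w i * (cmod (y i))\<^sup>2))"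
    by (rule sums_mult)
  have eq: "w i * Re ((A * y i - x i) * (cnj (x i) - cnj a * cnj (y i)))
    = Re ((cnj A + cnj a) * (complex_of_real (w i) * x i * cnj (y i)))
      - Re (A * cnj a) * (w i * (cmod (y i))\<^sup>2) - w i * (cmod (x i))\<^sup>2" for i
    unfolding cmod_power2 by (simp add: power2_eq_square algebra_simps)
  show ?thesis
    unfolding eq using sums_diff[OF sums_diff[OF P Y] X] by (rule sums_unique[symmetric])
qed

text \<open>Follows from the same expansion with one coefficient c in place of both \<open>A\<close>
  and \<open>a\<close>: the sum is then minus the weighted squared norm of c y - x, hence at most
  0.\<close>

lemma ell2w_Cauchy_Schwarz:
  assumes w: "\<And>i. 0 \<le> w i" and x: "x \<in> ell2w w K" and y: "y \<in> ell2w w K"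
  shows "(cmod (\<Sum>i. complex_of_real (w i) * x i * cnj (y i)))\<^sup>2
    \<le> (\<Sum>i. w i * (cmod (x i))\<^sup>2) * (\<Sum>i. w i * (cmod (y i))\<^sup>2)"
    (is "(cmod ?P)\<^sup>2 \<le> ?X * ?Y")
proof (cases "?Y = 0")
  case True
  \<comment> \<open>A nonnegative series with sum 0 has only zero terms, so at each index the weight
    or \<open>y i\<close> vanishes, which forces P = 0.\<close>
  then have "w i * (cmod (y i))\<^sup>2 = 0" for i
    using y w suminf_eq_zero_iff[of "\<lambda>i. w i * (cmod (y i))\<^sup>2"] by (auto simp: ell2w_def)
  then have "complex_of_real (w i) * x i * cnj (y i) = 0" for i
    by (metis complex_cnj_zero mult_eq_0_iff norm_eq_zero of_real_0 zero_eq_power2)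
  then have "?P = 0"
    by (simp only: suminf_zero)
  then show ?thesis
    using True by simp
next
  case False
  moreover have "0 \<le> ?Y"
    using y w by (auto simp: ell2w_def intro: suminf_nonneg)
  ultimately have Y: "0 < ?Y"
    by simp
  \<comment> \<open>The choice for which c y is the weighted orthogonal projection of x onto the
    line spanned by y.\<close>
  define c where "c = ?P / complex_of_real ?Y"
  have c: "c * complex_of_real ?Y = ?P"
    using False by (simp add: c_def)
  have "w i * Re ((c * y i - x i) * (cnj (x i) - cnj c * cnj (y i))) \<le> 0" for i
  proof (rule mult_nonneg_nonpos[OF w])
    have "Re ((c * y i - x i) * (cnj (x i) - cnj c * cnj (y i))) = - (cmod (c * y i - x i))\<^sup>2"
      unfolding cmod_power2 by (simp add: power2_eq_square algebra_simps)
    then show "Re ((c * y i - x i) * (cnj (x i) - cnj c * cnj (y i))) \<le> 0"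
      by simp
  qed
  then have "(\<Sum>i. w i * Re ((c * y i - x i) * (cnj (x i) - cnj c * cnj (y i)))) \<le> 0"
    using suminf_le[OF _ summable_ell2w_Re[OF w x y] summable_zero] by simp
  then have "Re ((cnj c + cnj c) * ?P) - Re (c * cnj c) * ?Y \<le> ?X"
    unfolding suminf_ell2w_diff[OF w x y] by simp
  \<comment> \<open>With P written as c Y, the left-hand side is 2 |c|^2 Y - |c|^2 Y. A free real
    \<open>Y\<close> keeps the infinite sums out of the simplification.\<close>
  moreover have "Re ((cnj c + cnj c) * (c * complex_of_real Y)) - Re (c * cnj c) * Y
      = (cmod c)\<^sup>2 * Y" for Y
    unfolding cmod_power2 by (simp add: power2_eq_square algebra_simps)
  from this[of ?Y] have "Re ((cnj c + cnj c) * ?P) - Re (c * cnj c) * ?Y = (cmod c)\<^sup>2 * ?Y"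
    unfolding c .
  ultimately have "(cmod c)\<^sup>2 * ?Y * ?Y \<le> ?X * ?Y"
    using Y by (simp add: mult_right_mono)
  moreover have "(cmod ?P)\<^sup>2 = (cmod c)\<^sup>2 * ?Y * ?Y"
    unfolding c[symmetric] norm_mult by (simp add: power2_eq_square)
  ultimately show ?thesis
    by simp
qed

lemma ell2w_Gruss:
  assumes w: "\<And>i. 0 \<le> w i" and x: "x \<in> ell2w w K" and y: "y \<in> ell2w w K"
    and nonneg: "0 \<le> (\<Sum>i. w i * Re ((A * y i - x i) * (cnj (x i) - cnj a * cnj (y i))))"
  shows "(\<Sum>i. w i * (cmod (x i))\<^sup>2) * (\<Sum>i. w i * (cmod (y i))\<^sup>2)
      - (cmod (\<Sum>i. complex_of_real (w i) * x i * cnj (y i)))\<^sup>2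
    \<le> 1 / 4 * (cmod (A - a))\<^sup>2 * (\<Sum>i. w i * (cmod (y i))\<^sup>2)\<^sup>2"
    (is "?X * ?Y - (cmod ?P)\<^sup>2 \<le> _")
proof -
  define m where "m = (A + a) / 2"
  have "0 \<le> ?Y"
    using y w by (auto simp: ell2w_def intro: suminf_nonneg)
  moreover have "?X \<le> Re ((cnj A + cnj a) * ?P) - Re (A * cnj a) * ?Y"
    using nonneg unfolding suminf_ell2w_diff[OF w x y] by simp
  ultimately have "?X * ?Y \<le> (Re ((cnj A + cnj a) * ?P) - Re (A * cnj a) * ?Y) * ?Y"
    by (rule mult_right_mono[rotated])
  \<comment> \<open>Rests on |m|^2 - |A - a|^2 / 4 = \<open>Re (A * cnj a)\<close> for the midpoint
    m.\<close>
  also have "(Re ((cnj A + cnj a) * p) - Re (A * cnj a) * Y) * Y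
      = 1 / 4 * (cmod (A - a))\<^sup>2 * Y\<^sup>2 + (cmod p)\<^sup>2 - (cmod (p - m * complex_of_real Y))\<^sup>2"
    for p Y
    unfolding m_def cmod_power2 by (simp add: power2_eq_square field_simps)
  finally show ?thesis
    using zero_le_power2[of "cmod (?P - m * complex_of_real ?Y)"] by linarith
qed

text \<open>A single real example serves both scalar fields. It has X = Y = 2, P = 0 and |A - a|^2 =
  4, so the bound reads 4 <= 16 C.\<close>

lemma ell2w_Gruss_sharp:
  fixes K :: "complex set" and C :: real
  assumes K: "\<real> \<subseteq> K"
    and bound: "\<And>(w :: nat \<Rightarrow> real) a A x y. \<lbrakk>\<And>i. 0 \<le> w i; a \<in> K; A \<in> K; x \<in> ell2w w K; y \<in> ell2w w K;
      0 \<le> (\<Sum>i. w i * Re ((A * y i - x i) * (cnj (x i) - cnj a * cnj (y i))))\<rbrakk> \<Longrightarrow>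
      (\<Sum>i. w i * (cmod (x i))\<^sup>2) * (\<Sum>i. w i * (cmod (y i))\<^sup>2)
          - (cmod (\<Sum>i. complex_of_real (w i) * x i * cnj (y i)))\<^sup>2
        \<le> C * (cmod (A - a))\<^sup>2 * (\<Sum>i. w i * (cmod (y i))\<^sup>2)\<^sup>2"
  shows "1 / 4 \<le> C"
proof -
  \<comment> \<open>The weights cut off everything after index 1, so later values of
    \<open>x\<close> and \<open>y\<close> are free. Keeping them of modulus 1 reduces both weighted
    norms to the sum of \<open>w\<close>.\<close>
  define w :: "nat \<Rightarrow> real" where "w = (\<lambda>i. if i < 2 then 1 else 0)"
  define x :: "nat \<Rightarrow> complex" where "x = (\<lambda>i. if i = 0 then 1 else -1)"
  define y :: "nat \<Rightarrow> complex" where "y = (\<lambda>i. 1)"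
  have norms: "cmod (x i) = 1" "cmod (y i) = 1" for i
    by (simp_all add: x_def y_def)
  have w_sums: "w sums 2"
    using sums_finite[of "{..<2}" w] by (simp add: w_def numeral_2_eq_2)
  have "(\<lambda>i. complex_of_real (w i) * x i * cnj (y i)) sums 0"
    using sums_finite[of "{..<2}" "\<lambda>i. complex_of_real (w i) * x i * cnj (y i)"]
    by (simp add: w_def x_def y_def numeral_2_eq_2)
  then have P: "(\<Sum>i. complex_of_real (w i) * x i * cnj (y i)) = 0"
    by (rule sums_unique[symmetric])
  have "range x \<subseteq> K" "range y \<subseteq> K"
    using K by (auto simp: x_def y_def)
  then have xy: "x \<in> ell2w w K" "y \<in> ell2w w K"
    using w_sums by (auto simp: ell2w_def norms sums_iff)
  \<comment> \<open>For real entries the product is the difference of the squares of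
    \<open>y i\<close> and \<open>x i\<close>, both equal to 1, so the hypothesis holds with
    equality.\<close>
  have zero: "w i * Re ((1 * y i - x i) * (cnj (x i) - cnj (-1) * cnj (y i))) = 0" for i
    by (simp add: x_def y_def)
  have "(\<Sum>i. w i * (cmod (x i))\<^sup>2) * (\<Sum>i. w i * (cmod (y i))\<^sup>2)
          - (cmod (\<Sum>i. complex_of_real (w i) * x i * cnj (y i)))\<^sup>2
        \<le> C * (cmod (1 - (- 1)))\<^sup>2 * (\<Sum>i. w i * (cmod (y i))\<^sup>2)\<^sup>2"
  proof (rule bound)
    show "1 \<in> K" "- 1 \<in> K"
      using K by auto
    show "0 \<le> (\<Sum>i. w i * Re ((1 * y i - x i) * (cnj (x i) - cnj (- 1) * cnj (y i))))"
      by (simp only: zero suminf_zero order.refl)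
  qed (use xy in \<open>simp_all add: w_def\<close>)
  then show ?thesis
    using w_sums by (simp add: norms P sums_iff)
qed

theorem proposition3:
  fixes K :: "complex set"
  assumes "K = \<real> \<or> K = UNIV"
  shows "(\<forall>(w :: nat \<Rightarrow> real) (a :: complex) (A :: complex) (x :: nat \<Rightarrow> complex) (y :: nat \<Rightarrow> complex).
            (\<forall>i. 0 \<le> w i) \<and> a \<in> K \<and> A \<in> K \<and> x \<in> ell2w w K \<and> y \<in> ell2w w K \<and>
            0 \<le> (\<Sum>i. w i * Re ((A * y i - x i) * (cnj (x i) - cnj a * cnj (y i))))
            \<longrightarrow>
            0 \<le> (\<Sum>i. w i * (cmod (x i))\<^sup>2) * (\<Sum>i. w i * (cmod (y i))\<^sup>2)
                  - (cmod (\<Sum>i. complex_of_real (w i) * x i * cnj (y i)))\<^sup>2 \<and>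
            (\<Sum>i. w i * (cmod (x i))\<^sup>2) * (\<Sum>i. w i * (cmod (y i))\<^sup>2)
                  - (cmod (\<Sum>i. complex_of_real (w i) * x i * cnj (y i)))\<^sup>2
              \<le> 1 / 4 * (cmod (A - a))\<^sup>2 * (\<Sum>i. w i * (cmod (y i))\<^sup>2)\<^sup>2)
         \<and>
         \<not> (\<exists>C :: real. C < 1 / 4 \<and>
            (\<forall>(w :: nat \<Rightarrow> real) (a :: complex) (A :: complex) (x :: nat \<Rightarrow> complex) (y :: nat \<Rightarrow> complex).
              (\<forall>i. 0 \<le> w i) \<and> a \<in> K \<and> A \<in> K \<and> x \<in> ell2w w K \<and> y \<in> ell2w w K \<and>
              0 \<le> (\<Sum>i. w i * Re ((A * y i - x i) * (cnj (x i) - cnj a * cnj (y i))))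
              \<longrightarrow>
              (\<Sum>i. w i * (cmod (x i))\<^sup>2) * (\<Sum>i. w i * (cmod (y i))\<^sup>2)
                  - (cmod (\<Sum>i. complex_of_real (w i) * x i * cnj (y i)))\<^sup>2
                \<le> C * (cmod (A - a))\<^sup>2 * (\<Sum>i. w i * (cmod (y i))\<^sup>2)\<^sup>2))"
proof (intro conjI notI allI impI; (elim exE conjE)?)
  fix w :: "nat \<Rightarrow> real" and a A :: complex and x y :: "nat \<Rightarrow> complex"
  assume w: "\<forall>i. 0 \<le> w i" and x: "x \<in> ell2w w K" and y: "y \<in> ell2w w K"
  show "0 \<le> (\<Sum>i. w i * (cmod (x i))\<^sup>2) * (\<Sum>i. w i * (cmod (y i))\<^sup>2)
      - (cmod (\<Sum>i. complex_of_real (w i) * x i * cnj (y i)))\<^sup>2"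
    using ell2w_Cauchy_Schwarz[OF _ x y] w by simp
  assume "0 \<le> (\<Sum>i. w i * Re ((A * y i - x i) * (cnj (x i) - cnj a * cnj (y i))))"
  then show "(\<Sum>i. w i * (cmod (x i))\<^sup>2) * (\<Sum>i. w i * (cmod (y i))\<^sup>2)
      - (cmod (\<Sum>i. complex_of_real (w i) * x i * cnj (y i)))\<^sup>2
    \<le> 1 / 4 * (cmod (A - a))\<^sup>2 * (\<Sum>i. w i * (cmod (y i))\<^sup>2)\<^sup>2"
    using ell2w_Gruss[OF _ x y] w by blast
next
  fix C :: real
  assume "C < 1 / 4" and
    "\<forall>(w :: nat \<Rightarrow> real) a A x y.
      (\<forall>i. 0 \<le> w i) \<and> a \<in> K \<and> A \<in> K \<and> x \<in> ell2w w K \<and> y \<in> ell2w w K \<and>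
      0 \<le> (\<Sum>i. w i * Re ((A * y i - x i) * (cnj (x i) - cnj a * cnj (y i))))
      \<longrightarrow> (\<Sum>i. w i * (cmod (x i))\<^sup>2) * (\<Sum>i. w i * (cmod (y i))\<^sup>2)
          - (cmod (\<Sum>i. complex_of_real (w i) * x i * cnj (y i)))\<^sup>2
        \<le> C * (cmod (A - a))\<^sup>2 * (\<Sum>i. w i * (cmod (y i))\<^sup>2)\<^sup>2"
  \<comment> \<open>Either field contains the reals, where the extremal example lives.\<close>
  moreover have "\<real> \<subseteq> K"
    using assms by auto
  ultimately show False
    using ell2w_Gruss_sharp[of K C] by (simp add: not_le)
qed

end
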